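(* Let $G\subsetneq\mathbb{R}^n$ be a domain, $x\in G$ and $r\in(0,1)$. If $r\le 1/2$, then the triangular ratio metric ball $B_s(x,r)=\{y\in G: s_G(x,y)<r\}$ is convex.
   Context: A domain is a nonempty open connected set. For a domain $G\subsetneq\mathbb{R}^n$ and $x,y\in G$, the triangular ratio metric is $$s_G(x,y)=\sup_{z\in\partial G}\frac{|x-y|}{|x-z|+|z-y|}\in[0,1],$$ where $|\cdot|$ is the Euclidean norm. *)

theory Defs
  imports "HOL-Analysis.Analysis"
begin

definition domain_set :: "(real ^ 'n) set \<Rightarrow> bool" where
  "domain_set G \<longleftrightarrow> G \<noteq> {} \<and> open G \<and> connected G"

text \<open>For a domain \<open>G \<noteq> UNIV\<close> and \<open>x, y \<in> G\<close>, the frontier of \<open>G\<close> is nonempty, all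
  denominators are positive, and the quotients lie in \<open>[0,1]\<close>, so the supremum over the reals is
  the genuine one. Outside this situation the value is not meaningful.\<close>

definition triangular_ratio :: "(real ^ 'n) set \<Rightarrow> real ^ 'n \<Rightarrow> real ^ 'n \<Rightarrow> real" where
  "triangular_ratio G x y = (SUP z\<in>frontier G. norm (x - y) / (norm (x - z) + norm (z - y)))"

definition triangular_ratio_ball :: "(real ^ 'n) set \<Rightarrow> real ^ 'n \<Rightarrow> real \<Rightarrow> (real ^ 'n) set" where
  "triangular_ratio_ball G x r = {y \<in> G. triangular_ratio G x y < r}"

end

theory Submission
  imports Defs
begin

text \<open>Fix a boundary point \<open>z\<close> and put \<open>x\<close> at the origin. Squaring
  \<open>|y| - r |z| \<le> r |z - y|\<close> shows that the points satisfying the bound for this single \<open>z\<close> form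
  the region \<open>\<rho> \<le> c (1 - r cos \<theta>)\<close> enclosed by a limacon, which is convex precisely when
  \<open>r \<le> 1/2\<close>. Intersecting over all \<open>z\<close> preserves convexity, and no point outside \<open>G\<close> survives,
  since a segment leaving \<open>G\<close> meets the boundary at a point where the ratio is 1.\<close>

text \<open>The region is a sublevel set of a positively homogeneous gauge. It suffices that, for
  every nonzero convex combination \<open>p\<close> of its points, some linear functional lies below
  a multiple of the gauge and agrees with it at \<open>p\<close>.\<close>

lemma convex_limacon:
  fixes e :: "'a::real_inner"
  assumes e: "norm e \<le> 1/2" and c: "c \<ge> 0"
  shows "convex {y. (norm y)\<^sup>2 \<le> c * (norm y - e \<bullet> y)}"
  unfolding convex_alt
proof (intro ballI allI impI, elim conjE)
  fix y1 y2 :: 'a and t :: real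
  assume y1: "y1 \<in> {y. (norm y)\<^sup>2 \<le> c * (norm y - e \<bullet> y)}"
    and y2: "y2 \<in> {y. (norm y)\<^sup>2 \<le> c * (norm y - e \<bullet> y)}"
    and t: "0 \<le> t" "t \<le> 1"
  define p where "p = (1 - t) *\<^sub>R y1 + t *\<^sub>R y2"
  have half: "e \<bullet> y \<le> norm y / 2" for y
  proof -
    have "e \<bullet> y \<le> norm e * norm y" by (rule norm_cauchy_schwarz)
    also have "\<dots> \<le> 1/2 * norm y" using e by (intro mult_right_mono) auto
    finally show ?thesis by simp
  qed
  have "(norm p)\<^sup>2 \<le> c * (norm p - e \<bullet> p)"
  proof (cases "p = 0")
    case False
    define a where "a = p /\<^sub>R norm p"
    define D where "D = 1 - e \<bullet> a"
    define L where "L y = (2 * D - 1) * (a \<bullet> y) + e \<bullet> y" for y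
    have na: "norm a = 1" using False by (simp add: a_def)
    have D: "D \<ge> 1/2" using half[of a] na by (simp add: D_def)
    txt \<open>The gauge \<open>|y|\<^sup>2 / (|y| - e \<bullet> y)\<close> of the region has gradient \<open>L / D\<^sup>2\<close> at \<open>a\<close>;
      the next bound says that this linear functional lies below the gauge.\<close>
    have support: "L y \<le> c * D\<^sup>2" if y: "(norm y)\<^sup>2 \<le> c * (norm y - e \<bullet> y)" for y
    proof (cases "y = 0")
      case True
      then show ?thesis using c by (simp add: L_def)
    next
      case False
      define u where "u = norm y - e \<bullet> y"
      have "norm y > 0" using False by simp
      then have u: "u > 0" using half[of y] unfolding u_def by linarith
      have m: "a \<bullet> y \<le> norm y" using norm_cauchy_schwarz[of a y] na by simp
      \<comment> \<open>Completing the square leaves a remainder with factor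
        \<open>2 * D - 1\<close>; its nonnegativity is where \<open>norm e \<le> 1/2\<close>
        enters.\<close>
      have "D\<^sup>2 * (norm y)\<^sup>2 - L y * u
          = (D * norm y - u)\<^sup>2 + u * (2 * D - 1) * (norm y - a \<bullet> y)"
        by (simp add: L_def u_def power2_eq_square algebra_simps)
      also have "\<dots> \<ge> 0" using u D m by (intro add_nonneg_nonneg mult_nonneg_nonneg) auto
      finally have "L y * u \<le> D\<^sup>2 * (norm y)\<^sup>2" by simp
      also have "\<dots> \<le> D\<^sup>2 * (c * u)" using y by (intro mult_left_mono) (auto simp: u_def)
      finally have "L y * u \<le> (c * D\<^sup>2) * u" by (simp add: algebra_simps)
      then show ?thesis using u by simp
    qed
    have pa: "p = norm p *\<^sub>R a" using False by (simp add: a_def)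
    have ap: "a \<bullet> p = norm p"
      using na by (subst pa) (simp add: dot_square_norm)
    have ep: "e \<bullet> p = norm p * (1 - D)"
      by (subst pa) (simp add: D_def)
    \<comment> \<open>At \<open>p\<close> the support bound is tight: \<open>L p\<close> is
      \<open>D\<^sup>2\<close> times the gauge of \<open>p\<close>.\<close>
    have "norm p * D = L p" by (simp add: L_def ap ep algebra_simps)
    also have "\<dots> = (1 - t) * L y1 + t * L y2"
      by (simp add: L_def p_def inner_add_right algebra_simps)
    also have "\<dots> \<le> c * D\<^sup>2"
      using support[of y1] support[of y2] y1 y2 t by (intro convex_bound_le) auto
    finally have "norm p * D \<le> (c * D) * D" by (simp add: power2_eq_square algebra_simps)
    then have "norm p \<le> c * D" using D by simp
    then have "norm p * norm p \<le> norm p * (c * D)" by (intro mult_left_mono) auto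
    then show ?thesis by (simp add: ep power2_eq_square algebra_simps)
  qed simp
  then show "(1 - t) *\<^sub>R y1 + t *\<^sub>R y2 \<in> {y. (norm y)\<^sup>2 \<le> c * (norm y - e \<bullet> y)}"
    by (simp add: p_def)
qed

text \<open>Squaring is reversible only when \<open>norm y - r * norm z\<close> is nonnegative;
  otherwise both inequalities hold outright.\<close>

lemma norm_le_iff_limacon:
  fixes y z :: "'a::real_inner"
  assumes r: "0 < r" "r < 1"
  shows "norm y \<le> r * (norm z + norm (z - y)) \<longleftrightarrow>
    (1 - r\<^sup>2) * (norm y)\<^sup>2 \<le> 2 * r * (norm z * norm y - r * (z \<bullet> y))"
proof (cases "norm y < r * norm z")
  case True
  have "r * (z \<bullet> y) \<le> r * (norm z * norm y)"
    using r norm_cauchy_schwarz by (intro mult_left_mono) auto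
  then have 1: "2 * r * ((1 - r) * (norm z * norm y)) \<le> 2 * r * (norm z * norm y - r * (z \<bullet> y))"
    using r by (intro mult_left_mono) (auto simp: algebra_simps)
  have "(1 - r\<^sup>2) * (norm y)\<^sup>2 = ((1 - r) * norm y) * ((1 + r) * norm y)"
    by (simp add: power2_eq_square algebra_simps)
  also have "\<dots> \<le> ((1 - r) * norm y) * (2 * (r * norm z))"
    using r True by (intro mult_left_mono mult_mono) auto
  also have "\<dots> = 2 * r * ((1 - r) * (norm z * norm y))" by simp
  finally have "(1 - r\<^sup>2) * (norm y)\<^sup>2 \<le> 2 * r * (norm z * norm y - r * (z \<bullet> y))"
    using 1 by linarith
  moreover have "norm y \<le> r * (norm z + norm (z - y))"
    using True r by (simp add: distrib_left add_increasing2)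
  ultimately show ?thesis by simp
next
  case False
  have "norm y \<le> r * (norm z + norm (z - y)) \<longleftrightarrow> norm y - r * norm z \<le> r * norm (z - y)"
    by (auto simp: algebra_simps)
  also have "\<dots> \<longleftrightarrow> (norm y - r * norm z)\<^sup>2 \<le> (r * norm (z - y))\<^sup>2"
    using False r by (intro power_mono_iff[symmetric]) auto
  also have "(r * norm (z - y))\<^sup>2 = r\<^sup>2 * ((norm z)\<^sup>2 + (norm y)\<^sup>2 - 2 * (z \<bullet> y))"
    by (simp add: power_mult_distrib power2_norm_eq_inner inner_diff inner_commute)
  also have "(norm y - r * norm z)\<^sup>2 \<le> \<dots> \<longleftrightarrow>
      (1 - r\<^sup>2) * (norm y)\<^sup>2 \<le> 2 * r * (norm z * norm y - r * (z \<bullet> y))"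
    by (simp add: power2_eq_square algebra_simps)
  finally show ?thesis .
qed

lemma convex_ratio_sublevel:
  fixes x z :: "'a::real_inner"
  assumes r: "0 < r" "r \<le> 1/2"
  shows "convex {y. norm (x - y) \<le> r * (norm (x - z) + norm (z - y))}"
proof (cases "z = x")
  case True
  have "norm (x - y) \<le> r * norm (x - y) \<longleftrightarrow> y = x" for y
    using r by (auto simp: mult_le_cancel_right1)
  then show ?thesis using True by simp
next
  case False
  define w where "w = z - x"
  \<comment> \<open>Dividing the squared inequality by \<open>1 - r\<^sup>2\<close> yields the
    limacon with these \<open>e\<close> and \<open>c\<close>; \<open>e\<close> has length exactly
    \<open>r\<close>.\<close>
  define e where "e = (r / norm w) *\<^sub>R w"
  define c where "c = 2 * r * norm w / (1 - r\<^sup>2)"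
  have w: "norm w > 0" using False by (simp add: w_def)
  have r2: "1 - r\<^sup>2 > 0" using r by (simp add: power_less_one_iff abs_square_less_1)
  have "norm y \<le> r * (norm w + norm (w - y)) \<longleftrightarrow> (norm y)\<^sup>2 \<le> c * (norm y - e \<bullet> y)" for y
  proof -
    have "c * (norm y - e \<bullet> y) = 2 * r * (norm w * norm y - r * (w \<bullet> y)) / (1 - r\<^sup>2)"
      using w r2 by (simp add: c_def e_def field_simps)
    then show ?thesis
      using norm_le_iff_limacon[of r y w] r r2 by (simp add: pos_le_divide_eq mult.commute)
  qed
  moreover have "norm e \<le> 1/2" using r w by (simp add: e_def)
  moreover have "c \<ge> 0" using r r2 by (simp add: c_def)
  ultimately have "convex {y. norm y \<le> r * (norm w + norm (w - y))}"
    using convex_limacon[of e c] by simp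
  then have "convex ((+) x ` {y. norm y \<le> r * (norm w + norm (w - y))})"
    by (rule convex_translation)
  also have "(+) x ` {y. norm y \<le> r * (norm w + norm (w - y))}
      = {y. norm (x - y) \<le> r * (norm (x - z) + norm (z - y))}" (is "?A = ?B")
  proof
    show "?A \<subseteq> ?B" by (auto simp: w_def norm_minus_commute algebra_simps)
    show "?B \<subseteq> ?A"
    proof
      fix y assume "y \<in> ?B"
      then have "y - x \<in> {y. norm y \<le> r * (norm w + norm (w - y))}"
        by (simp add: w_def norm_minus_commute)
      then show "y \<in> ?A" by (rule rev_image_eqI) simp
    qed
  qed
  finally show ?thesis .
qed

text \<open>At a frontier point on the segment from \<open>x\<close> to \<open>y\<close> the
  triangle inequality is an equality, which contradicts the bound for \<open>r < 1\<close>.\<close>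

lemma frontier_ratio_le_imp_mem:
  fixes G :: "'a::real_normed_vector set"
  assumes "x \<in> G" and r: "r < 1"
    and le: "\<And>z. z \<in> frontier G \<Longrightarrow> norm (x - y) \<le> r * (norm (x - z) + norm (z - y))"
  shows "y \<in> G"
proof (rule ccontr)
  assume "y \<notin> G"
  then have "closed_segment x y \<inter> frontier G \<noteq> {}"
    using \<open>x \<in> G\<close> by (intro connected_Int_frontier) auto
  then obtain z where z: "z \<in> closed_segment x y" "z \<in> frontier G" by blast
  obtain u where u: "0 \<le> u" "u \<le> 1" "z = (1 - u) *\<^sub>R x + u *\<^sub>R y"
    using z(1) by (auto simp: in_segment)
  then have "x - z = u *\<^sub>R (x - y)" "z - y = (1 - u) *\<^sub>R (x - y)"
    by (auto simp: algebra_simps)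
  then have "norm (x - z) + norm (z - y) = u * norm (x - y) + (1 - u) * norm (x - y)"
    using u(1,2) by simp
  also have "\<dots> = norm (x - y)" by (simp add: algebra_simps)
  finally have "norm (x - z) + norm (z - y) = norm (x - y)" .
  then have "norm (x - y) \<le> r * norm (x - y)" using le[OF z(2)] by simp
  moreover have "norm (x - y) > 0" using \<open>x \<in> G\<close> \<open>y \<notin> G\<close> by auto
  ultimately show False using r by auto
qed

text \<open>An open set misses its frontier, so the denominators are positive, and the triangle
  inequality bounds the quotients by 1. Hence the supremum is genuine, even for \<open>y\<close>
  outside \<open>G\<close>.\<close>

lemma triangular_ratio_le_iff:
  assumes "open G" "frontier G \<noteq> {}" "x \<in> G"
  shows "triangular_ratio G x y \<le> r \<longleftrightarrow>
    (\<forall>z\<in>frontier G. norm (x - y) \<le> r * (norm (x - z) + norm (z - y)))"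
proof -
  have pos: "norm (x - z) + norm (z - y) > 0" if "z \<in> frontier G" for z
  proof -
    have "x \<noteq> z" using that assms by (auto simp: frontier_def interior_open)
    then show ?thesis by (simp add: add_pos_nonneg)
  qed
  have "norm (x - y) \<le> norm (x - z) + norm (z - y)" for z
    using norm_triangle_ineq[of "x - z" "z - y"] by simp
  then have "bdd_above ((\<lambda>z. norm (x - y) / (norm (x - z) + norm (z - y))) ` frontier G)"
    using pos by (intro bdd_aboveI2[where M = 1]) (simp add: divide_le_eq_1)
  then have "triangular_ratio G x y \<le> r \<longleftrightarrow>
      (\<forall>z\<in>frontier G. norm (x - y) / (norm (x - z) + norm (z - y)) \<le> r)"
    unfolding triangular_ratio_def using assms(2) by (intro cSUP_le_iff) auto
  then show ?thesis using pos by (simp add: pos_divide_le_eq)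
qed

theorem theorem2p3:
  fixes G :: "(real ^ 'n) set" and x :: "real ^ 'n" and r :: real
  assumes "domain_set G" and "G \<noteq> UNIV"
    and "x \<in> G"
    and "r \<in> {0<..<1}"
    and "r \<le> 1/2"
  shows "convex (triangular_ratio_ball G x r)"
  unfolding convex_contains_segment
proof (intro ballI subsetI)
  fix y1 y2 p
  assume y: "y1 \<in> triangular_ratio_ball G x r" "y2 \<in> triangular_ratio_ball G x r"
    and p: "p \<in> closed_segment y1 y2"
  have G: "open G" "frontier G \<noteq> {}"
    using assms(1-3) frontier_eq_empty by (auto simp: domain_set_def)
  note le_iff = triangular_ratio_le_iff[OF G assms(3)]
  txt \<open>The supremum may turn strict pointwise bounds into a weak one, so pass to a smaller
    radius at which both endpoints satisfy the weak bound.\<close>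
  define q where "q = Max {r / 2, triangular_ratio G x y1, triangular_ratio G x y2}"
  \<comment> \<open>The entry \<open>r / 2\<close> keeps \<open>q\<close> positive even if both
    endpoints equal \<open>x\<close>.\<close>
  have q: "0 < q" "q < r" "triangular_ratio G x y1 \<le> q" "triangular_ratio G x y2 \<le> q"
    using y assms(4) by (auto simp: q_def triangular_ratio_ball_def less_max_iff_disj)
  have le: "norm (x - p) \<le> q * (norm (x - z) + norm (z - p))" if z: "z \<in> frontier G" for z
  proof -
    have "convex {y. norm (x - y) \<le> q * (norm (x - z) + norm (z - y))}"
      using q assms(5) by (intro convex_ratio_sublevel) auto
    from closed_segment_subset[OF _ _ this] show ?thesis
      using q z p le_iff by blast
  qed
  have "p \<in> G" using assms(3-5) q le by (intro frontier_ratio_le_imp_mem[of x G q p]) auto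
  moreover have "triangular_ratio G x p \<le> q" using le le_iff by blast
  ultimately show "p \<in> triangular_ratio_ball G x r" using q by (simp add: triangular_ratio_ball_def)
qed

end
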